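(* Let $n\ge1$, $Q=2n+2$, $1<r,s<\infty$ and $0<\lambda<Q$ with $\frac1r+\frac1s+\frac\lambda Q=2$. Then for all $f\in L^r(\mathbb H^n)$ and $g\in L^s(\mathbb H^n)$, $$\left|\int\int_{\mathbb H^n\times\mathbb H^n}\frac{\overline{f(u)}\,g(v)}{|u^{-1}v|^\lambda}\,du\,dv\right|\le C\,\|f\|_r\|g\|_s$$ with $$C=\frac{Q\,|B_1(0)|^{\lambda/Q}}{rs(Q-\lambda)}\left[\left(\frac{\lambda/Q}{1-1/r}\right)^{\lambda/Q}+\left(\frac{\lambda/Q}{1-1/s}\right)^{\lambda/Q}\right],$$ where $B_1(0)=\{u\in\mathbb H^n: |u|<1\}$ is the unit Heisenberg ball and $|B_1(0)|$ is its volume, namely $$|B_1(0)|=\frac{2\pi^{\frac{Q-2}{2}}\,\Gamma(1/2)\,\Gamma((Q+2)/4)}{(Q-2)\,\Gamma((Q-2)/2)\,\Gamma((Q+4)/4)}.$$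
   Context: The Heisenberg group is $\mathbb H^n=\mathbb C^n\times\mathbb R$ with group law $(z,t)(z',t')=(z+z',\,t+t'+2\,\mathrm{Im}(z\cdot\overline{z'}))$, where $z\cdot\overline{z'}=\sum_{j=1}^n z_j\overline{z_j'}$; the inverse is $(z,t)^{-1}=(-z,-t)$. Haar measure is Lebesgue measure $du=dz\,dt$ (on $\mathbb R^{2n+1}$), and $\|\cdot\|_r$, $\|\cdot\|_s$ are the norms of $L^r(\mathbb H^n)$, $L^s(\mathbb H^n)$ (complex-valued functions). The homogeneous norm is $|(z,t)|=(|z|^4+t^2)^{1/4}$, and $Q=2n+2$ is the homogeneous dimension. *)

theory Defs
  imports "HOL-Analysis.Analysis"
begin

text \<open>
  The Heisenberg group of dimension \<open>n = CARD('n)\<close>. The library's \<open>+\<close>, \<open>-\<close> and norm on this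
  product type are those of the underlying Euclidean space; the group law, inverse and
  homogeneous norm are the constants below.
\<close>

type_synonym 'n heis = "(complex, 'n) vec \<times> real"

definition herm_dot :: "complex ^ 'n \<Rightarrow> complex ^ 'n \<Rightarrow> complex" where
  "herm_dot z w = (\<Sum>j\<in>UNIV. z $ j * cnj (w $ j))"

definition heis_mult :: "'n::finite heis \<Rightarrow> 'n heis \<Rightarrow> 'n heis" where
  "heis_mult u v = (fst u + fst v, snd u + snd v + 2 * Im (herm_dot (fst u) (fst v)))"

definition heis_inv :: "'n::finite heis \<Rightarrow> 'n heis" where
  "heis_inv u = (- fst u, - snd u)"

definition heis_norm :: "'n::finite heis \<Rightarrow> real" where
  "heis_norm u = (norm (fst u) ^ 4 + (snd u)\<^sup>2) powr (1 / 4)"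

definition heis_ball :: "real \<Rightarrow> ('n::finite heis) set" where
  "heis_ball R = {u. heis_norm u < R}"

text \<open>
  \<open>L\<^sup>p\<close> for finite \<open>p\<close>, as a set of Lebesgue measurable functions (no quotient by almost
  everywhere equality is taken).
\<close>

definition Lp_space :: "real \<Rightarrow> ('a::euclidean_space \<Rightarrow> complex) set" where
  "Lp_space p = {f \<in> borel_measurable lebesgue. integrable lebesgue (\<lambda>x. cmod (f x) powr p)}"

definition Lp_norm :: "real \<Rightarrow> ('a::euclidean_space \<Rightarrow> complex) \<Rightarrow> real" where
  "Lp_norm p f = (\<integral>x. cmod (f x) powr p \<partial>lebesgue) powr (1 / p)"

text \<open>
  At \<open>u = v\<close> the quotient is \<open>0\<close> by the convention \<open>x / 0 = 0\<close>; the diagonal is a null set.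
\<close>

definition HLS_integrand ::
  "real \<Rightarrow> ('n::finite heis \<Rightarrow> complex) \<Rightarrow> ('n heis \<Rightarrow> complex) \<Rightarrow> 'n heis \<times> 'n heis \<Rightarrow> complex"
where
  "HLS_integrand l f g =
     (\<lambda>(u, v). cnj (f u) * g v / complex_of_real (heis_norm (heis_mult (heis_inv u) v) powr l))"

end

theory Submission imports Defs begin

text \<open>
  The argument is the one of Lieb and Loss for the Euclidean inequality and only uses that the
  balls of the left-invariant quasi-distance \<open>|u\<^sup>-\<^sup>1v|\<close> of radius \<open>c\<close> have volume \<open>|B\<^sub>1| c\<^sup>Q\<close>. Writing
  \<open>|u\<^sup>-\<^sup>1v|\<^sup>-\<^sup>\<lambda>\<close> as an integral over \<open>c\<close> of indicators of balls bounds its integral over \<open>A \<times> B\<close> by a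
  constant times the minimum of \<open>|A| |B|\<^sup>1\<^sup>-\<^sup>\<lambda>\<^sup>/\<^sup>Q\<close> and \<open>|A|\<^sup>1\<^sup>-\<^sup>\<lambda>\<^sup>/\<^sup>Q |B|\<close>. Decomposing \<open>|f|\<close> and \<open>|g|\<close> into their
  superlevel sets leaves a double integral in the two distribution functions, which Hoelder's
  inequality estimates in terms of \<open>\<parallel>f\<parallel>\<^sub>r\<close> and \<open>\<parallel>g\<parallel>\<^sub>s\<close>.
\<close>

subsection \<open>Integrals of powers\<close>

lemma nn_integral_powr_from_0:
  fixes p T :: real
  assumes "-1 < p" "0 \<le> T"
  shows "(\<integral>\<^sup>+x. ennreal (x powr p) * indicator {0<..T} x \<partial>lborel) = ennreal (T powr (p + 1) / (p + 1))"
proof -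
  have "(\<integral>\<^sup>+x. ennreal (x powr p) * indicator {0<..T} x \<partial>lborel)
      = (\<integral>\<^sup>+x. ennreal (x powr p) * indicator {0..T} x \<partial>lborel)"
  proof (rule nn_integral_cong_AE)
    show "AE x in lborel. ennreal (x powr p) * indicator {0<..T} x = ennreal (x powr p) * indicator {0..T} x"
      using AE_lborel_singleton[of 0] by eventually_elim (auto split: split_indicator)
  qed
  also have "\<dots> = ennreal (T powr (p + 1) / (p + 1))"
    by (intro nn_integral_has_integral_lebesgue' has_integral_powr_from_0 assms) auto
  finally show ?thesis .
qed

lemma nn_integral_powr_to_inf:
  fixes e a :: real
  assumes "e < -1" "0 < a"
  shows "(\<integral>\<^sup>+x. ennreal (x powr e) * indicator {a<..} x \<partial>lborel) = ennreal (a powr (e + 1) / (- e - 1))"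
proof -
  have "(\<integral>\<^sup>+x. ennreal (x powr e) * indicator {a<..} x \<partial>lborel)
      = (\<integral>\<^sup>+x. ennreal (x powr e) * indicator {a..} x \<partial>lborel)"
  proof (rule nn_integral_cong_AE)
    show "AE x in lborel. ennreal (x powr e) * indicator {a<..} x = ennreal (x powr e) * indicator {a..} x"
      using AE_lborel_singleton[of a] by eventually_elim (auto split: split_indicator)
  qed
  also have "\<dots> = ennreal (- (a powr (e + 1)) / (e + 1))"
    by (intro nn_integral_has_integral_lebesgue' has_integral_powr_to_inf assms) auto
  also have "- (a powr (e + 1)) / (e + 1) = a powr (e + 1) / (- e - 1)"
    using assms by (simp add: field_simps)
  finally show ?thesis .
qed

section \<open>Kernel integrals over a single set\<close>

text \<open>Integrating over the level \<open>c\<close>, the set where \<open>K y < c\<close> inside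
  \<open>B\<close> has measure at most both \<open>V * c powr Q\<close> and \<open>|B|\<close>. The
  first bound is used for small \<open>c\<close>, where \<open>c powr (Q - l - 1)\<close> is
  integrable at 0 because \<open>l < Q\<close>; the second for large \<open>c\<close>, where
  \<open>c powr (- l - 1)\<close> is integrable because \<open>0 < l\<close>.\<close>

lemma (in sigma_finite_measure) nn_integral_kernel_le:
  fixes K :: "'a \<Rightarrow> real" and l Q V :: real
  assumes K[measurable]: "K \<in> borel_measurable M" and K0: "\<And>y. y \<in> space M \<Longrightarrow> 0 \<le> K y"
    and balls: "\<And>c. 0 < c \<Longrightarrow> emeasure M {y \<in> space M. K y < c} \<le> ennreal (V * c powr Q)"
    and l: "0 < l" "l < Q" and V: "0 < V"
    and B[measurable]: "B \<in> sets M" and Bfin: "emeasure M B < \<infinity>"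
  shows "(\<integral>\<^sup>+y. ennreal (K y powr - l) * indicator B y \<partial>M)
           \<le> ennreal (Q / (Q - l) * V powr (l / Q) * measure M B powr (1 - l / Q))"
proof (cases "measure M B = 0")
  case True
  then have "emeasure M B = 0" using Bfin by (simp add: emeasure_eq_ennreal_measure top.not_eq_extremum)
  then have "B \<in> null_sets M" by (auto simp: null_sets_def)
  then have "(\<integral>\<^sup>+y. ennreal (K y powr - l) * indicator B y \<partial>M) = 0"
    by (intro nn_integral_null_set) auto
  then show ?thesis by simp
next
  case False
  define b where "b = measure M B"
  have b: "0 < b" using False by (simp add: b_def zero_less_measure_iff)
  have Bb: "emeasure M B = ennreal b"
    using Bfin by (simp add: b_def emeasure_eq_ennreal_measure top.not_eq_extremum)
  \<comment> \<open>The radius at which the two bounds agree, \<open>V * R powr Q = b\<close>. It is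
    positive since \<open>b\<close> is, which is why null sets are treated separately.\<close>
  define R where "R = (b / V) powr (1 / Q)"
  have R: "0 < R" using b V by (simp add: R_def)
  have RQ: "R powr Q = b / V" using b V l by (simp add: R_def powr_powr)
  \<comment> \<open>Only an inequality: at \<open>K y = 0\<close> the left side is 0 by the
    convention \<open>0 powr - l = 0\<close>, while the integral on the right diverges.\<close>
  have layer: "ennreal (K y powr - l) \<le>
      (\<integral>\<^sup>+c. ennreal (l * c powr (- l - 1)) * indicator {0<..} c * indicator {x. K y < x} c \<partial>lborel)"
    if "y \<in> space M" for y
  proof (cases "K y = 0")
    case False
    then have Ky: "0 < K y" using K0[OF that] by simp
    have "(\<integral>\<^sup>+c. ennreal (l * c powr (- l - 1)) * indicator {0<..} c * indicator {x. K y < x} c \<partial>lborel)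
      = (\<integral>\<^sup>+c. ennreal l * (ennreal (c powr (- l - 1)) * indicator {K y<..} c) \<partial>lborel)"
      using Ky l by (intro nn_integral_cong) (auto split: split_indicator simp: ennreal_mult)
    also have "\<dots> = ennreal l * ennreal (K y powr (- l - 1 + 1) / (- (- l - 1) - 1))"
      using l Ky by (subst nn_integral_cmult) (simp_all add: nn_integral_powr_to_inf)
    also have "\<dots> = ennreal (K y powr - l)"
      using l by (simp add: ennreal_mult[symmetric])
    finally show ?thesis by simp
  qed simp
  have "(\<integral>\<^sup>+y. ennreal (K y powr - l) * indicator B y \<partial>M) \<le>
     (\<integral>\<^sup>+y. (\<integral>\<^sup>+c. ennreal (l * c powr (- l - 1)) * indicator {0<..} c * indicator {x. K y < x} c * indicator B y \<partial>lborel) \<partial>M)"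
    using layer by (intro nn_integral_mono) (auto split: split_indicator)
  also have "\<dots> = (\<integral>\<^sup>+c. (\<integral>\<^sup>+y. ennreal (l * c powr (- l - 1)) * indicator {0<..} c * indicator {x. K y < x} c * indicator B y \<partial>M) \<partial>lborel)"
    by (intro pair_sigma_finite.Fubini' pair_sigma_finite.intro sigma_finite_measure_axioms sigma_finite_lborel) simp
  also have "\<dots> = (\<integral>\<^sup>+c. ennreal (l * c powr (- l - 1)) * indicator {0<..} c * emeasure M {y \<in> space M. K y < c \<and> y \<in> B} \<partial>lborel)"
  proof (intro nn_integral_cong)
    fix c :: real
    have "(\<integral>\<^sup>+y. ennreal (l * c powr (- l - 1)) * indicator {0<..} c * indicator {x. K y < x} c * indicator B y \<partial>M)
      = (\<integral>\<^sup>+y. ennreal (l * c powr (- l - 1)) * indicator {0<..} c * indicator {y \<in> space M. K y < c \<and> y \<in> B} y \<partial>M)"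
      by (intro nn_integral_cong) (auto split: split_indicator)
    then show "(\<integral>\<^sup>+y. ennreal (l * c powr (- l - 1)) * indicator {0<..} c * indicator {x. K y < x} c * indicator B y \<partial>M)
      = ennreal (l * c powr (- l - 1)) * indicator {0<..} c * emeasure M {y \<in> space M. K y < c \<and> y \<in> B}"
      by (simp add: nn_integral_cmult)
  qed
  also have "\<dots> \<le> (\<integral>\<^sup>+c. ennreal (l * V) * (ennreal (c powr (Q - l - 1)) * indicator {0<..R} c)
       + ennreal (l * b) * (ennreal (c powr (- l - 1)) * indicator {R<..} c) \<partial>lborel)"
  proof (intro nn_integral_mono)
    fix c :: real
    let ?E = "emeasure M {y \<in> space M. K y < c \<and> y \<in> B}"
    have 1: "?E \<le> ennreal b" unfolding Bb[symmetric] by (intro emeasure_mono) auto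
    have 2: "?E \<le> ennreal (V * c powr Q)" if "0 < c"
    proof -
      have "?E \<le> emeasure M {y \<in> space M. K y < c}" by (intro emeasure_mono) auto
      with balls[OF that] show ?thesis by simp
    qed
    show "ennreal (l * c powr (- l - 1)) * indicator {0<..} c * ?E
      \<le> ennreal (l * V) * (ennreal (c powr (Q - l - 1)) * indicator {0<..R} c)
       + ennreal (l * b) * (ennreal (c powr (- l - 1)) * indicator {R<..} c)"
    proof (cases "c \<le> 0 \<or> c > R")
      case True
      show ?thesis
      proof (cases "c \<le> 0")
        case False
        with True have "c > R" by simp
        then have "ennreal (l * c powr (- l - 1)) * ?E \<le> ennreal (l * b) * ennreal (c powr (- l - 1))"
          using mult_left_mono[OF 1, of "ennreal (l * c powr (- l - 1))"] l b
          by (simp add: ennreal_mult[symmetric] mult_ac)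
        then show ?thesis using R \<open>c > R\<close> by simp
      qed simp
    next
      case False
      then have c: "0 < c" "c \<le> R" by auto
      have "l * c powr (- l - 1) * (V * c powr Q) = l * V * c powr (Q - l - 1)"
        using c by (simp add: powr_add[symmetric] algebra_simps)
      then have "ennreal (l * c powr (- l - 1)) * ennreal (V * c powr Q)
          = ennreal (l * V) * ennreal (c powr (Q - l - 1))"
        using l V by (simp only: ennreal_mult[symmetric] mult_nonneg_nonneg powr_ge_zero less_imp_le)
      with mult_left_mono[OF 2[OF c(1)], of "ennreal (l * c powr (- l - 1))"]
      have "ennreal (l * c powr (- l - 1)) * ?E \<le> ennreal (l * V) * ennreal (c powr (Q - l - 1))"
        by simp
      then show ?thesis using c by simp
    qed
  qed
  also have "\<dots> = ennreal (l * V) * ennreal (R powr (Q - l - 1 + 1) / (Q - l - 1 + 1))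
       + ennreal (l * b) * ennreal (R powr (- l - 1 + 1) / (- (- l - 1) - 1))"
    using l R by (simp add: nn_integral_add nn_integral_cmult nn_integral_powr_from_0 nn_integral_powr_to_inf)
  also have "\<dots> = ennreal (l * V * (R powr (Q - l) / (Q - l)) + b * R powr - l)"
    using l V b by (simp add: ennreal_mult[symmetric] ennreal_plus[symmetric] del: ennreal_plus)
  \<comment> \<open>By the choice of \<open>R\<close> both pieces are multiples of
    \<open>b * R powr - l\<close>, with coefficients \<open>l / (Q - l)\<close> and 1, whose sum is
    \<open>Q / (Q - l)\<close>.\<close>
  also have "R powr (Q - l) = b / V * R powr - l"
    unfolding RQ[symmetric] by (simp add: powr_add[symmetric])
  also have "l * V * (b / V * R powr - l / (Q - l)) + b * R powr - l = Q / (Q - l) * (b * R powr - l)"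
    using l V by (simp add: field_simps)
  also have "R powr - l = V powr (l / Q) * b powr (- l / Q)"
    using b V l by (simp add: R_def powr_powr powr_divide powr_minus_divide)
  also have "Q / (Q - l) * (b * (V powr (l / Q) * b powr (- l / Q))) =
      Q / (Q - l) * V powr (l / Q) * (b powr 1 * b powr (- l / Q))"
    using b by simp
  also have "b powr 1 * b powr (- l / Q) = b powr (1 - l / Q)"
    using powr_add[of b 1 "- l / Q"] by simp
  finally show ?thesis by (simp add: b_def)
qed

text \<open>
  Hoelder's inequality for \<open>w\<^sup>1\<^sup>-\<^sup>\<alpha> = (w b\<^sup>s\<^sup>-\<^sup>1)\<^sup>1\<^sup>-\<^sup>\<alpha> (b\<^sup>-\<^sup>m\<^sup>/\<^sup>\<alpha>)\<^sup>\<alpha>\<close>, obtained by integrating Young's inequality between the two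
  factors after normalizing each by the bound \<open>1/s\<close>, resp. the value \<open>Y\<close>, of its integral.
\<close>

lemma nn_integral_powr_Holder:
  fixes w :: "real \<Rightarrow> real" and s \<alpha> T :: real
  assumes w[measurable]: "w \<in> borel_measurable borel" and w0: "\<And>b. 0 \<le> w b"
    and s: "1 < s" and \<alpha>: "0 < \<alpha>" "\<alpha> < 1" and \<delta>: "0 < 1 / s + \<alpha> - 1" and T: "0 < T"
    and X: "(\<integral>\<^sup>+b. ennreal (b powr (s - 1) * w b) * indicator {0<..} b \<partial>lborel) \<le> ennreal (1 / s)"
  shows "(\<integral>\<^sup>+b. ennreal (w b powr (1 - \<alpha>)) * indicator {0<..T} b \<partial>lborel)
    \<le> ennreal (1 / s * (\<alpha> / (1 / s + \<alpha> - 1)) powr \<alpha> * T powr (s * (1 / s + \<alpha> - 1)))"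
proof -
  define d where "d = 1 / s + \<alpha> - 1"
  have d: "0 < d" using \<delta> by (simp add: d_def)
  define m where "m = (s - 1) * (1 - \<alpha>)"
  \<comment> \<open>Positivity of \<open>d\<close> is thus exactly what makes
    \<open>b powr (- m / \<alpha>)\<close> integrable at 0.\<close>
  have m1: "1 - m / \<alpha> = s * d / \<alpha>"
    using s \<alpha> by (simp add: m_def d_def field_simps)
  then have mp: "- 1 < - m / \<alpha>" using s d \<alpha> by (smt (verit) divide_pos_pos mult_pos_pos minus_divide_left)
  define Y where "Y = T powr (s * d / \<alpha>) / (s * d / \<alpha>)"
  have Y: "0 < Y" using T s d \<alpha> by (simp add: Y_def)
  have Yint: "(\<integral>\<^sup>+b. ennreal (b powr (- m / \<alpha>)) * indicator {0<..T} b \<partial>lborel) = ennreal Y"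
    using nn_integral_powr_from_0[OF mp, of T] T m1 by (simp add: Y_def)
  \<comment> \<open>The value expected from Hoelder's inequality: the product of the bounds for the
    two integrals, raised to \<open>1 - \<alpha>\<close> and \<open>\<alpha>\<close>.\<close>
  define Z where "Z = (1 / s) powr (1 - \<alpha>) * Y powr \<alpha>"
  have Z: "0 < Z" using s Y by (simp add: Z_def)
  have pointwise: "w b powr (1 - \<alpha>) \<le> Z * (1 - \<alpha>) * s * (b powr (s - 1) * w b) + Z * \<alpha> / Y * b powr (- m / \<alpha>)"
    if b: "0 < b" for b
  proof (cases "w b = 0")
    case True
    then show ?thesis using Z \<alpha> Y by simp
  next
    case False
    then have wb: "0 < w b" using w0[of b] by simp
    define x where "x = s * b powr (s - 1) * w b"
    define y where "y = b powr (- m / \<alpha>) / Y"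
    \<comment> \<open>The weights \<open>b powr m\<close> and \<open>b powr - m\<close> of the two
      factors cancel, so the left side is \<open>w b powr (1 - \<alpha>) / Z\<close>.\<close>
    have "x powr (1 - \<alpha>) * y powr \<alpha> \<le> (1 - \<alpha>) * x + \<alpha> * y"
      using \<alpha> wb b s Y by (intro Youngs_inequality_0) (auto simp: x_def y_def)
    moreover have "x powr (1 - \<alpha>) = s powr (1 - \<alpha>) * b powr m * w b powr (1 - \<alpha>)"
      using b wb s by (simp add: x_def powr_mult powr_powr m_def)
    moreover have "y powr \<alpha> = b powr - m / Y powr \<alpha>"
      using b Y \<alpha> by (simp add: y_def powr_divide powr_powr)
    moreover have "b powr m * b powr - m = 1" using b by (simp add: powr_add[symmetric])
    moreover have "(1 / s) powr (1 - \<alpha>) * s powr (1 - \<alpha>) = 1"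
      using s by (simp add: powr_divide)
    ultimately have "w b powr (1 - \<alpha>) / Z \<le> (1 - \<alpha>) * x + \<alpha> * y"
      using s Y b by (simp add: Z_def field_simps powr_divide powr_minus)
    then have "w b powr (1 - \<alpha>) \<le> Z * ((1 - \<alpha>) * x + \<alpha> * y)"
      using Z by (simp add: field_simps)
    then show ?thesis by (simp add: x_def y_def algebra_simps)
  qed
  have "(\<integral>\<^sup>+b. ennreal (w b powr (1 - \<alpha>)) * indicator {0<..T} b \<partial>lborel) \<le>
     (\<integral>\<^sup>+b. ennreal (Z * (1 - \<alpha>) * s) * (ennreal (b powr (s - 1) * w b) * indicator {0<..} b)
        + ennreal (Z * \<alpha> / Y) * (ennreal (b powr (- m / \<alpha>)) * indicator {0<..T} b) \<partial>lborel)"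
  proof (intro nn_integral_mono)
    fix b :: real
    show "ennreal (w b powr (1 - \<alpha>)) * indicator {0<..T} b \<le>
      ennreal (Z * (1 - \<alpha>) * s) * (ennreal (b powr (s - 1) * w b) * indicator {0<..} b)
        + ennreal (Z * \<alpha> / Y) * (ennreal (b powr (- m / \<alpha>)) * indicator {0<..T} b)"
    proof (cases "b \<in> {0<..T}")
      case True
      have "ennreal (Z * (1 - \<alpha>) * s) * ennreal (b powr (s - 1) * w b) + ennreal (Z * \<alpha> / Y) * ennreal (b powr (- m / \<alpha>))
        = ennreal (Z * (1 - \<alpha>) * s * (b powr (s - 1) * w b) + Z * \<alpha> / Y * b powr (- m / \<alpha>))"
        using Z \<alpha> s Y w0[of b]
        by (simp only: ennreal_mult[symmetric] ennreal_plus[symmetric] mult_nonneg_nonneg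
          divide_nonneg_nonneg less_imp_le diff_gt_0_iff_gt zero_less_one powr_ge_zero order_less_trans[OF zero_less_one])
      with True ennreal_leI[OF pointwise[of b]] show ?thesis by simp
    qed simp
  qed
  also have "\<dots> = ennreal (Z * (1 - \<alpha>) * s) * (\<integral>\<^sup>+b. ennreal (b powr (s - 1) * w b) * indicator {0<..} b \<partial>lborel)
      + ennreal (Z * \<alpha> / Y) * ennreal Y"
    by (simp only: nn_integral_add nn_integral_cmult Yint[symmetric] measurable)
       (subst nn_integral_add; simp add: nn_integral_cmult)
  also have "\<dots> \<le> ennreal (Z * (1 - \<alpha>) * s) * ennreal (1 / s) + ennreal (Z * \<alpha> / Y) * ennreal Y"
    by (intro add_right_mono mult_left_mono X) simp
  also have "\<dots> = ennreal (Z * (1 - \<alpha>) * s * (1 / s) + Z * \<alpha> / Y * Y)"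
    using Z \<alpha> s Y by (simp only: ennreal_mult[symmetric] ennreal_plus[symmetric] mult_nonneg_nonneg
      divide_nonneg_nonneg less_imp_le diff_gt_0_iff_gt zero_less_one)
  also have "Z * (1 - \<alpha>) * s * (1 / s) + Z * \<alpha> / Y * Y = Z"
    using s Y by (simp add: field_simps)
  also have "Z = 1 / s * (\<alpha> / d) powr \<alpha> * T powr (s * d)"
  proof -
    \<comment> \<open>The factor \<open>1 / s\<close> contained in \<open>Y\<close> supplies the
      missing power \<open>\<alpha>\<close> of \<open>1 / s\<close> in \<open>Z\<close>.\<close>
    have "Y = T powr (s * d / \<alpha>) * ((\<alpha> / d) * (1 / s))" using s d \<alpha> by (simp add: Y_def)
    then have "Y powr \<alpha> = T powr (s * d) * ((\<alpha> / d) powr \<alpha> * (1 / s) powr \<alpha>)"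
      using s d \<alpha> T by (simp only: powr_mult powr_powr) simp
    moreover have "(1 / s) powr (1 - \<alpha>) * (1 / s) powr \<alpha> = 1 / s"
      using s by (simp add: powr_add[symmetric])
    ultimately show ?thesis by (simp add: Z_def) (metis mult.commute mult.left_commute times_divide_eq_right mult.right_neutral)
  qed
  finally show ?thesis by (simp add: d_def)
qed

text \<open>
  The quadrant is split along \<open>b = a\<^sup>r\<^sup>/\<^sup>s\<close>, one term of the minimum being used on each side; this curve makes
  the power of \<open>a\<close> coming out of the inner integral exactly \<open>a\<^sup>r\<^sup>-\<^sup>1\<close>.
\<close>

lemma nn_integral_min_powr_le:
  fixes v w :: "real \<Rightarrow> real" and r s \<alpha> :: real
  assumes v[measurable]: "v \<in> borel_measurable borel" and v0: "\<And>a. 0 \<le> v a"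
    and w[measurable]: "w \<in> borel_measurable borel" and w0: "\<And>b. 0 \<le> w b"
    and r: "1 < r" and s: "1 < s" and \<alpha>: "0 < \<alpha>" "\<alpha> < 1" and exps: "1 / r + 1 / s + \<alpha> = 2"
    and X: "(\<integral>\<^sup>+a. ennreal (a powr (r - 1) * v a) * indicator {0<..} a \<partial>lborel) \<le> ennreal (1 / r)"
    and Y: "(\<integral>\<^sup>+b. ennreal (b powr (s - 1) * w b) * indicator {0<..} b \<partial>lborel) \<le> ennreal (1 / s)"
  shows "(\<integral>\<^sup>+a. (\<integral>\<^sup>+b. ennreal (min (v a * w b powr (1 - \<alpha>)) (v a powr (1 - \<alpha>) * w b))
              * indicator {0<..} b \<partial>lborel) * indicator {0<..} a \<partial>lborel)
    \<le> ennreal (1 / (r * s) * ((\<alpha> / (1 - 1 / r)) powr \<alpha> + (\<alpha> / (1 - 1 / s)) powr \<alpha>))"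
proof -
  \<comment> \<open>Stated for fresh \<open>v\<close>, \<open>w\<close>, \<open>r\<close>,
    \<open>s\<close>, since the region above the curve is handled by the same estimate with the
    roles of the two functions exchanged.\<close>
  have half: "(\<integral>\<^sup>+a. (\<integral>\<^sup>+b. ennreal (v a * w b powr (1 - \<alpha>)) * indicator {0<..a powr (r / s)} b \<partial>lborel)
        * indicator {0<..} a \<partial>lborel) \<le> ennreal (1 / (r * s) * (\<alpha> / (1 - 1 / r)) powr \<alpha>)"
    if [measurable]: "v \<in> borel_measurable borel" and v0: "\<And>a. 0 \<le> v a"
    and [measurable]: "w \<in> borel_measurable borel" and w0: "\<And>b. 0 \<le> w b"
    and r: "1 < r" and s: "1 < s" and exps: "1 / r + 1 / s + \<alpha> = 2"
    and X: "(\<integral>\<^sup>+a. ennreal (a powr (r - 1) * v a) * indicator {0<..} a \<partial>lborel) \<le> ennreal (1 / r)"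
    and Y: "(\<integral>\<^sup>+b. ennreal (b powr (s - 1) * w b) * indicator {0<..} b \<partial>lborel) \<le> ennreal (1 / s)"
    for v w :: "real \<Rightarrow> real" and r s :: real
  proof -
    define c where "c = 1 / s * (\<alpha> / (1 - 1 / r)) powr \<alpha>"
    have c: "0 \<le> c" using s by (simp add: c_def)
    \<comment> \<open>This is where the denominator \<open>1 - 1 / r\<close> of the final constant
      comes from; its positivity is the assumption of the Hoelder estimate.\<close>
    have d: "1 / s + \<alpha> - 1 = 1 - 1 / r" using exps by simp
    have "(\<integral>\<^sup>+b. ennreal (v a * w b powr (1 - \<alpha>)) * indicator {0<..a powr (r / s)} b \<partial>lborel)
        \<le> ennreal c * ennreal (a powr (r - 1) * v a)" if a: "0 < a" for a
    proof -
      have "(\<integral>\<^sup>+b. ennreal (w b powr (1 - \<alpha>)) * indicator {0<..a powr (r / s)} b \<partial>lborel)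
        \<le> ennreal (1 / s * (\<alpha> / (1 / s + \<alpha> - 1)) powr \<alpha> * (a powr (r / s)) powr (s * (1 / s + \<alpha> - 1)))"
        using r a d by (intro nn_integral_powr_Holder w0 s \<alpha> Y) auto
      also have "(a powr (r / s)) powr (s * (1 / s + \<alpha> - 1)) = a powr (r - 1)"
      proof -
        have "r / s * (s * (1 - 1 / r)) = r - 1" using r s by (simp add: field_simps)
        then show ?thesis unfolding d powr_powr by simp
      qed
      finally have *: "(\<integral>\<^sup>+b. ennreal (w b powr (1 - \<alpha>)) * indicator {0<..a powr (r / s)} b \<partial>lborel)
        \<le> ennreal (c * a powr (r - 1))" unfolding d c_def .
      have "(\<integral>\<^sup>+b. ennreal (v a * w b powr (1 - \<alpha>)) * indicator {0<..a powr (r / s)} b \<partial>lborel)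
        = ennreal (v a) * (\<integral>\<^sup>+b. ennreal (w b powr (1 - \<alpha>)) * indicator {0<..a powr (r / s)} b \<partial>lborel)"
        by (simp add: nn_integral_cmult[symmetric] ennreal_mult v0 mult.assoc)
      also have "\<dots> \<le> ennreal (v a) * ennreal (c * a powr (r - 1))"
        by (intro mult_left_mono *) simp
      also have "\<dots> = ennreal c * ennreal (a powr (r - 1) * v a)"
        using c v0[of a] by (simp add: ennreal_mult[symmetric] mult_ac)
      finally show ?thesis .
    qed
    then have "(\<integral>\<^sup>+a. (\<integral>\<^sup>+b. ennreal (v a * w b powr (1 - \<alpha>)) * indicator {0<..a powr (r / s)} b \<partial>lborel)
        * indicator {0<..} a \<partial>lborel) \<le>
        (\<integral>\<^sup>+a. ennreal c * (ennreal (a powr (r - 1) * v a) * indicator {0<..} a) \<partial>lborel)"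
      by (intro nn_integral_mono) (auto split: split_indicator)
    also have "\<dots> = ennreal c * (\<integral>\<^sup>+a. ennreal (a powr (r - 1) * v a) * indicator {0<..} a \<partial>lborel)"
      by (simp add: nn_integral_cmult)
    also have "\<dots> \<le> ennreal c * ennreal (1 / r)" by (intro mult_left_mono X) simp
    also have "\<dots> = ennreal (1 / (r * s) * (\<alpha> / (1 - 1 / r)) powr \<alpha>)"
      using c r by (simp only: ennreal_mult[symmetric] divide_nonneg_nonneg less_imp_le zero_le_one)
         (simp add: c_def mult.commute)
    finally show ?thesis .
  qed
  let ?f = "\<lambda>a b. ennreal (v a * w b powr (1 - \<alpha>)) * indicator {0<..a powr (r / s)} b * indicator {0<..} a"
  let ?g = "\<lambda>a b. ennreal (w b * v a powr (1 - \<alpha>)) * indicator {0<..b powr (s / r)} a * indicator {0<..} b"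
  have pointwise: "ennreal (min (v a * w b powr (1 - \<alpha>)) (v a powr (1 - \<alpha>) * w b))
      * indicator {0<..} b * indicator {0<..} a \<le> ?f a b + ?g a b" for a b
  proof (cases "0 < a \<and> 0 < b")
    case True
    show ?thesis
    proof (cases "b \<le> a powr (r / s)")
      case b: True
      have "ennreal (min (v a * w b powr (1 - \<alpha>)) (v a powr (1 - \<alpha>) * w b)) \<le> ?f a b"
        using b True by (auto intro!: ennreal_leI)
      then show ?thesis using True by (simp add: add_increasing2)
    next
      case False
      \<comment> \<open>Above the curve the condition is solved for \<open>a\<close>, so that
        \<open>a\<close> becomes the inner variable of the mirrored half.\<close>
      then have "(a powr (r / s)) powr (s / r) \<le> b powr (s / r)"
        using r s by (intro powr_mono2) auto
      then have "a \<le> b powr (s / r)" using r s True by (simp add: powr_powr)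
      then have "ennreal (min (v a * w b powr (1 - \<alpha>)) (v a powr (1 - \<alpha>) * w b)) \<le> ?g a b"
        using True by (auto intro!: ennreal_leI simp: mult.commute)
      then show ?thesis using True by (simp add: add_increasing)
    qed
  qed (auto simp: indicator_def)
  \<comment> \<open>The endpoint of the interval moves with the other variable; rewriting the
    indicators as one condition on the pair makes joint measurability visible.\<close>
  have [measurable]: "(\<lambda>x. ?f (fst x) (snd x)) \<in> borel_measurable (lborel \<Otimes>\<^sub>M lborel)"
  proof -
    have "(\<lambda>x. ?f (fst x) (snd x)) = (\<lambda>x. ennreal (v (fst x) * w (snd x) powr (1 - \<alpha>)) *
       (if 0 < snd x \<and> snd x \<le> fst x powr (r / s) \<and> 0 < fst x then 1 else 0 :: ennreal))"
      by (auto split: split_indicator)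
    then show ?thesis by simp
  qed
  have gm': "(\<lambda>x. ?g (fst x) (snd x)) \<in> borel_measurable (lborel \<Otimes>\<^sub>M lborel)"
  proof -
    have "(\<lambda>x. ?g (fst x) (snd x)) = (\<lambda>x. ennreal (w (snd x) * v (fst x) powr (1 - \<alpha>)) *
       (if 0 < fst x \<and> fst x \<le> snd x powr (s / r) \<and> 0 < snd x then 1 else 0 :: ennreal))"
      by (auto split: split_indicator)
    then show ?thesis by simp
  qed
  have fm: "(\<lambda>b. ?f a b) \<in> borel_measurable lborel" "(\<lambda>a. \<integral>\<^sup>+b. ?f a b \<partial>lborel) \<in> borel_measurable lborel" for a
    by simp (rule lborel.borel_measurable_nn_integral, simp add: case_prod_beta)
  have gm: "(\<lambda>b. ?g a b) \<in> borel_measurable lborel" "(\<lambda>a. \<integral>\<^sup>+b. ?g a b \<partial>lborel) \<in> borel_measurable lborel" for a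
  proof -
    show "(\<lambda>b. ?g a b) \<in> borel_measurable lborel"
      using measurable_Pair2[of "\<lambda>x. ?g (fst x) (snd x)" lborel lborel borel a]
      by (simp only: fst_conv snd_conv gm' space_lborel space_borel UNIV_I simp_thms)
  qed (rule lborel.borel_measurable_nn_integral, unfold case_prod_beta, rule gm')
  have "(\<integral>\<^sup>+a. (\<integral>\<^sup>+b. ennreal (min (v a * w b powr (1 - \<alpha>)) (v a powr (1 - \<alpha>) * w b))
              * indicator {0<..} b \<partial>lborel) * indicator {0<..} a \<partial>lborel)
     = (\<integral>\<^sup>+a. (\<integral>\<^sup>+b. ennreal (min (v a * w b powr (1 - \<alpha>)) (v a powr (1 - \<alpha>) * w b))
              * indicator {0<..} b * indicator {0<..} a \<partial>lborel) \<partial>lborel)"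
    by (simp add: nn_integral_multc)
  also have "\<dots> \<le> (\<integral>\<^sup>+a. (\<integral>\<^sup>+b. ?f a b + ?g a b \<partial>lborel) \<partial>lborel)"
    by (intro nn_integral_mono pointwise)
  also have "\<dots> = (\<integral>\<^sup>+a. \<integral>\<^sup>+b. ?f a b \<partial>lborel \<partial>lborel) + (\<integral>\<^sup>+a. \<integral>\<^sup>+b. ?g a b \<partial>lborel \<partial>lborel)"
    by (simp only: nn_integral_add fm gm)
  also have "(\<integral>\<^sup>+a. \<integral>\<^sup>+b. ?g a b \<partial>lborel \<partial>lborel) = (\<integral>\<^sup>+b. \<integral>\<^sup>+a. ?g a b \<partial>lborel \<partial>lborel)"
    by (rule lborel_pair.Fubini'[symmetric], unfold case_prod_beta, rule gm')
  also have "(\<integral>\<^sup>+a. \<integral>\<^sup>+b. ?f a b \<partial>lborel \<partial>lborel) + (\<integral>\<^sup>+b. \<integral>\<^sup>+a. ?g a b \<partial>lborel \<partial>lborel)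
    \<le> ennreal (1 / (r * s) * (\<alpha> / (1 - 1 / r)) powr \<alpha>) + ennreal (1 / (s * r) * (\<alpha> / (1 - 1 / s)) powr \<alpha>)"
    using half[OF v v0 w w0 r s exps X Y] half[OF w w0 v v0 s r _ Y X] exps
    by (intro add_mono) (simp_all add: nn_integral_multc add_ac)
  also have "\<dots> = ennreal (1 / (r * s) * ((\<alpha> / (1 - 1 / r)) powr \<alpha> + (\<alpha> / (1 - 1 / s)) powr \<alpha>))"
    using r s by (subst ennreal_plus[symmetric]) (auto simp: algebra_simps)
  finally show ?thesis .
qed

subsection \<open>The inequality for a kernel with balls of homogeneous volume\<close>

text \<open>\<open>F x\<close> is the length of the interval from 0 to \<open>F x\<close>, and
  Tonelli exchanges the integrals. The weight \<open>H\<close> allows the formula to be applied to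
  one variable of a double integral while the other stays integrated inside.\<close>

lemma (in sigma_finite_measure) nn_integral_layer_cake:
  fixes F :: "'a \<Rightarrow> real" and H :: "'a \<Rightarrow> ennreal"
  assumes [measurable]: "F \<in> borel_measurable M" "H \<in> borel_measurable M"
    and F0: "\<And>x. x \<in> space M \<Longrightarrow> 0 \<le> F x"
  shows "(\<integral>\<^sup>+x. ennreal (F x) * H x \<partial>M)
    = (\<integral>\<^sup>+a. (\<integral>\<^sup>+x. indicator {x. a < F x} x * H x \<partial>M) * indicator {0<..} a \<partial>lborel)"
proof -
  have "(\<integral>\<^sup>+x. ennreal (F x) * H x \<partial>M) =
      (\<integral>\<^sup>+x. (\<integral>\<^sup>+a. indicator {x. a < F x} x * H x * indicator {0<..} a \<partial>lborel) \<partial>M)"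
  proof (intro nn_integral_cong)
    fix x assume x: "x \<in> space M"
    have "(\<integral>\<^sup>+a. indicator {x. a < F x} x * H x * indicator {0<..} a \<partial>lborel)
        = (\<integral>\<^sup>+a. H x * indicator {0<..<F x} a \<partial>lborel)"
      by (intro nn_integral_cong) (auto split: split_indicator)
    also have "\<dots> = H x * ennreal (F x)"
      using F0[OF x] by (simp add: nn_integral_cmult)
    finally show "ennreal (F x) * H x = (\<integral>\<^sup>+a. indicator {x. a < F x} x * H x * indicator {0<..} a \<partial>lborel)"
      by (simp add: mult.commute)
  qed
  also have "\<dots> = (\<integral>\<^sup>+a. (\<integral>\<^sup>+x. indicator {x. a < F x} x * H x * indicator {0<..} a \<partial>M) \<partial>lborel)"
    by (intro pair_sigma_finite.Fubini' pair_sigma_finite.intro sigma_finite_measure_axioms sigma_finite_lborel) simp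
  also have "\<dots> = (\<integral>\<^sup>+a. (\<integral>\<^sup>+x. indicator {x. a < F x} x * H x \<partial>M) * indicator {0<..} a \<partial>lborel)"
    by (intro nn_integral_cong nn_integral_multc) simp
  finally show ?thesis .
qed

text \<open>Tonelli applied to \<open>F x powr r / r\<close> written as the integral of
  \<open>a powr (r - 1)\<close> over \<open>a\<close> from 0 to \<open>F x\<close>.\<close>

lemma (in sigma_finite_measure) nn_integral_powr_superlevel:
  fixes F :: "'a \<Rightarrow> real" and r :: real
  assumes [measurable]: "F \<in> borel_measurable M"
    and F0: "\<And>x. x \<in> space M \<Longrightarrow> 0 \<le> F x" and r: "0 < r"
  shows "(\<integral>\<^sup>+a. ennreal (a powr (r - 1)) * emeasure M {x \<in> space M. a < F x} * indicator {0<..} a \<partial>lborel)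
     \<le> (\<integral>\<^sup>+x. ennreal (F x powr r / r) \<partial>M)"
proof -
  have "(\<integral>\<^sup>+a. ennreal (a powr (r - 1)) * emeasure M {x \<in> space M. a < F x} * indicator {0<..} a \<partial>lborel)
     = (\<integral>\<^sup>+a. (\<integral>\<^sup>+x. ennreal (a powr (r - 1)) * indicator {x. a < F x} x * indicator {0<..} a \<partial>M) \<partial>lborel)"
  proof (intro nn_integral_cong)
    fix a :: real
    have "(\<integral>\<^sup>+x. ennreal (a powr (r - 1)) * indicator {x. a < F x} x * indicator {0<..} a \<partial>M)
      = (\<integral>\<^sup>+x. (ennreal (a powr (r - 1)) * indicator {0<..} a) * indicator {x \<in> space M. a < F x} x \<partial>M)"
      by (intro nn_integral_cong) (auto split: split_indicator)
    also have "\<dots> = ennreal (a powr (r - 1)) * indicator {0<..} a * emeasure M {x \<in> space M. a < F x}"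
      by (simp add: nn_integral_cmult)
    finally show "ennreal (a powr (r - 1)) * emeasure M {x \<in> space M. a < F x} * indicator {0<..} a
      = (\<integral>\<^sup>+x. ennreal (a powr (r - 1)) * indicator {x. a < F x} x * indicator {0<..} a \<partial>M)"
      by (simp add: mult_ac)
  qed
  also have "\<dots> = (\<integral>\<^sup>+x. (\<integral>\<^sup>+a. ennreal (a powr (r - 1)) * indicator {x. a < F x} x * indicator {0<..} a \<partial>lborel) \<partial>M)"
    by (intro pair_sigma_finite.Fubini'[symmetric] pair_sigma_finite.intro sigma_finite_measure_axioms sigma_finite_lborel) simp
  also have "\<dots> \<le> (\<integral>\<^sup>+x. ennreal (F x powr r / r) \<partial>M)"
  proof (intro nn_integral_mono)
    fix x assume x: "x \<in> space M"
    have "(\<integral>\<^sup>+a. ennreal (a powr (r - 1)) * indicator {x. a < F x} x * indicator {0<..} a \<partial>lborel)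
       \<le> (\<integral>\<^sup>+a. ennreal (a powr (r - 1)) * indicator {0<..F x} a \<partial>lborel)"
      by (intro nn_integral_mono) (auto split: split_indicator)
    also have "\<dots> = ennreal (F x powr r / r)"
      using nn_integral_powr_from_0[of "r - 1" "F x"] r F0[OF x] by simp
    finally show "(\<integral>\<^sup>+a. ennreal (a powr (r - 1)) * indicator {x. a < F x} x * indicator {0<..} a \<partial>lborel)
       \<le> ennreal (F x powr r / r)" .
  qed
  finally show ?thesis .
qed

text \<open>Prepares the distribution function of a normalized function for the one-dimensional
  inequality, which needs it real-valued. Finiteness at positive levels is Markov's inequality for
  \<open>F x powr r\<close>.\<close>

lemma (in sigma_finite_measure) superlevel_measure:
  fixes F :: "'a \<Rightarrow> real" and r :: real
  assumes F[measurable]: "F \<in> borel_measurable M"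
    and F0: "\<And>x. x \<in> space M \<Longrightarrow> 0 \<le> F x" and r: "0 < r"
    and fin: "(\<integral>\<^sup>+x. ennreal (F x powr r) \<partial>M) \<le> 1"
  shows superlevel_finite: "\<And>a. 0 < a \<Longrightarrow> emeasure M {x \<in> space M. a < F x} < \<infinity>"
    and superlevel_measurable: "(\<lambda>a. measure M {x \<in> space M. a < F x}) \<in> borel_measurable borel"
    and superlevel_powr_le: "(\<integral>\<^sup>+a. ennreal (a powr (r - 1) * measure M {x \<in> space M. a < F x}) * indicator {0<..} a \<partial>lborel)
          \<le> ennreal (1 / r)"
proof -
  show fin': "emeasure M {x \<in> space M. a < F x} < \<infinity>" if a: "0 < a" for a
  proof -
    have "emeasure M {x \<in> space M. a < F x}
        \<le> emeasure M {x \<in> space M. 1 \<le> ennreal (1 / a powr r) * ennreal (F x powr r)}"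
    proof (intro emeasure_mono subsetI)
      fix x assume "x \<in> {x \<in> space M. a < F x}"
      then have x: "x \<in> space M" "a powr r \<le> F x powr r"
        using a r by (auto intro!: powr_mono2)
      then have "1 \<le> 1 / a powr r * F x powr r" using a by (simp add: field_simps)
      then show "x \<in> {x \<in> space M. 1 \<le> ennreal (1 / a powr r) * ennreal (F x powr r)}"
        using x by (simp add: ennreal_mult[symmetric])
    qed simp
    also have "\<dots> \<le> ennreal (1 / a powr r) * (\<integral>\<^sup>+x. ennreal (F x powr r) * indicator (space M) x \<partial>M)"
      by (rule order_trans[OF _ nn_integral_Markov_inequality])
         (auto intro!: eq_refl arg_cong[where f="emeasure M"])
    also have "(\<integral>\<^sup>+x. ennreal (F x powr r) * indicator (space M) x \<partial>M) = (\<integral>\<^sup>+x. ennreal (F x powr r) \<partial>M)"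
      by (intro nn_integral_cong) simp
    also have "ennreal (1 / a powr r) * \<dots> < \<infinity>"
      using fin by (auto simp: ennreal_mult_less_top intro: le_less_trans)
    finally show ?thesis .
  qed
  \<comment> \<open>The condition \<open>a < F x\<close> is jointly measurable in \<open>a\<close>
    and \<open>x\<close>, so integrating out \<open>x\<close> leaves a measurable function of
    \<open>a\<close>.\<close>
  have "(\<lambda>a. \<integral>\<^sup>+x. indicator {x. a < F x} x \<partial>M) \<in> borel_measurable borel"
    by measurable
  also have "(\<lambda>a. \<integral>\<^sup>+x. indicator {x. a < F x} x \<partial>M) = (\<lambda>a. emeasure M {x \<in> space M. a < F x})"
  proof
    fix a
    have "(\<integral>\<^sup>+x. indicator {x. a < F x} x \<partial>M) = (\<integral>\<^sup>+x. indicator {x \<in> space M. a < F x} x \<partial>M)"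
      by (intro nn_integral_cong) (auto split: split_indicator)
    then show "(\<integral>\<^sup>+x. indicator {x. a < F x} x \<partial>M) = emeasure M {x \<in> space M. a < F x}" by simp
  qed
  finally show "(\<lambda>a. measure M {x \<in> space M. a < F x}) \<in> borel_measurable borel"
    unfolding measure_def by measurable
  have "(\<integral>\<^sup>+a. ennreal (a powr (r - 1) * measure M {x \<in> space M. a < F x}) * indicator {0<..} a \<partial>lborel)
    = (\<integral>\<^sup>+a. ennreal (a powr (r - 1)) * emeasure M {x \<in> space M. a < F x} * indicator {0<..} a \<partial>lborel)"
  proof (intro nn_integral_cong)
    fix a :: real
    show "ennreal (a powr (r - 1) * measure M {x \<in> space M. a < F x}) * indicator {0<..} a
      = ennreal (a powr (r - 1)) * emeasure M {x \<in> space M. a < F x} * indicator {0<..} a"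
      \<comment> \<open>For \<open>a \<le> 0\<close> the superlevel set may have infinite measure,
        but there the indicator is 0 on both sides.\<close>
      using fin'[of a] by (cases "0 < a") (simp_all add: ennreal_mult emeasure_eq_ennreal_measure less_top)
  qed
  also have "\<dots> \<le> (\<integral>\<^sup>+x. ennreal (F x powr r / r) \<partial>M)"
    by (rule nn_integral_powr_superlevel) (use F0 r in auto)
  also have "\<dots> = (\<integral>\<^sup>+x. ennreal (1 / r) * ennreal (F x powr r) \<partial>M)"
    using r by (intro nn_integral_cong) (simp add: ennreal_mult[symmetric])
  also have "\<dots> = ennreal (1 / r) * (\<integral>\<^sup>+x. ennreal (F x powr r) \<partial>M)"
    by (rule nn_integral_cmult) simp
  also have "\<dots> \<le> ennreal (1 / r) * 1" by (intro mult_left_mono fin) simp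
  finally show "(\<integral>\<^sup>+a. ennreal (a powr (r - 1) * measure M {x \<in> space M. a < F x}) * indicator {0<..} a \<partial>lborel)
          \<le> ennreal (1 / r)" by simp
qed

text \<open>Isolates what the inequality takes from the geometry: sublevel sets of \<open>K\<close>
  grow at most like \<open>c powr Q\<close> in each variable, uniformly in the other. Bounds on both
  sides are assumed because each term of the minimum in \<open>set_integral_le\<close> comes from
  integrating first in a different variable.\<close>

locale hls_kernel = pair_sigma_finite M1 M2
  for M1 :: "'a measure" and M2 :: "'b measure" +
  fixes K :: "'a \<times> 'b \<Rightarrow> real" and Q V :: real
  assumes K_measurable[measurable]: "K \<in> borel_measurable (M1 \<Otimes>\<^sub>M M2)"
    and K_nonneg: "\<And>x. 0 \<le> K x"
    and left_balls: "\<And>v c. v \<in> space M2 \<Longrightarrow> 0 < c \<Longrightarrow> emeasure M1 {u \<in> space M1. K (u, v) < c} \<le> ennreal (V * c powr Q)"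
    and right_balls: "\<And>u c. u \<in> space M1 \<Longrightarrow> 0 < c \<Longrightarrow> emeasure M2 {v \<in> space M2. K (u, v) < c} \<le> ennreal (V * c powr Q)"
    and V_pos: "0 < V"
begin

text \<open>Bounding the inner integral over \<open>A\<close> uniformly in \<open>v\<close> and then
  integrating over \<open>B\<close> gives one term of the minimum; doing so in the opposite order,
  after Tonelli, gives the other.\<close>

lemma set_integral_le:
  assumes l: "0 < l" "l < Q"
    and [measurable]: "A \<in> sets M1" "B \<in> sets M2"
    and fin: "emeasure M1 A < \<infinity>" "emeasure M2 B < \<infinity>"
  defines "a \<equiv> measure M1 A" and "b \<equiv> measure M2 B"
  shows "(\<integral>\<^sup>+v. (\<integral>\<^sup>+u. ennreal (K (u, v) powr - l) * indicator A u \<partial>M1) * indicator B v \<partial>M2)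
     \<le> ennreal (Q / (Q - l) * V powr (l / Q)) *
        ennreal (min (a * b powr (1 - l / Q)) (a powr (1 - l / Q) * b))" (is "?I \<le> _")
proof -
  define c where "c = Q / (Q - l) * V powr (l / Q)"
  have c: "0 \<le> c" using l by (simp add: c_def)
  have ab: "0 \<le> a" "0 \<le> b" "emeasure M1 A = ennreal a" "emeasure M2 B = ennreal b"
    using fin by (auto simp: a_def b_def emeasure_eq_ennreal_measure less_top)
  have "?I \<le> (\<integral>\<^sup>+v. ennreal (c * a powr (1 - l / Q)) * indicator B v \<partial>M2)"
    unfolding a_def c_def
    by (intro nn_integral_mono mult_right_mono M1.nn_integral_kernel_le left_balls l fin K_nonneg V_pos) auto
  also have "\<dots> = ennreal (c * a powr (1 - l / Q)) * ennreal b"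
    using ab by (simp only: nn_integral_cmult_indicator assms)
  also have "\<dots> = ennreal c * ennreal (a powr (1 - l / Q) * b)"
    using c ab by (simp only: ennreal_mult[symmetric] mult_nonneg_nonneg powr_ge_zero mult.assoc)
  finally have 1: "?I \<le> ennreal c * ennreal (a powr (1 - l / Q) * b)" .
  have "?I = (\<integral>\<^sup>+v. (\<integral>\<^sup>+u. ennreal (K (u, v) powr - l) * indicator A u * indicator B v \<partial>M1) \<partial>M2)"
    by (intro nn_integral_cong nn_integral_multc[symmetric]) simp
  also have "\<dots> = (\<integral>\<^sup>+u. (\<integral>\<^sup>+v. ennreal (K (u, v) powr - l) * indicator A u * indicator B v \<partial>M2) \<partial>M1)"
    by (intro Fubini') simp
  also have "\<dots> = (\<integral>\<^sup>+u. (\<integral>\<^sup>+v. ennreal (K (u, v) powr - l) * indicator B v \<partial>M2) * indicator A u \<partial>M1)"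
    by (intro nn_integral_cong, subst nn_integral_multc[symmetric]) (auto simp: mult_ac)
  also have "\<dots> \<le> (\<integral>\<^sup>+u. ennreal (c * b powr (1 - l / Q)) * indicator A u \<partial>M1)"
    unfolding b_def c_def
    by (intro nn_integral_mono mult_right_mono M2.nn_integral_kernel_le right_balls l fin K_nonneg V_pos) auto
  also have "\<dots> = ennreal (c * b powr (1 - l / Q)) * ennreal a"
    using ab by (simp only: nn_integral_cmult_indicator assms)
  also have "\<dots> = ennreal c * ennreal (a * b powr (1 - l / Q))"
    using c ab by (simp only: ennreal_mult[symmetric] mult_nonneg_nonneg powr_ge_zero mult.assoc mult.commute[of a])
  finally have 2: "?I \<le> ennreal c * ennreal (a * b powr (1 - l / Q))" .
  from 1 2 show ?thesis unfolding c_def[symmetric] by (simp add: min_def)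
qed

text \<open>The layer-cake formula in each variable reduces the double integral to kernel integrals
  over pairs of superlevel sets. \<open>set_integral_le\<close> bounds these by distribution
  functions, and \<open>nn_integral_min_powr_le\<close> with \<open>\<alpha> = l / Q\<close>
  finishes.\<close>

lemma hls_normalized:
  fixes F :: "'a \<Rightarrow> real" and G :: "'b \<Rightarrow> real"
  assumes l: "0 < l" "l < Q" and r: "1 < r" and s: "1 < s" and exps: "1 / r + 1 / s + l / Q = 2"
    and F[measurable]: "F \<in> borel_measurable M1" and F0: "\<And>x. 0 \<le> F x"
    and G[measurable]: "G \<in> borel_measurable M2" and G0: "\<And>x. 0 \<le> G x"
    and Fr: "(\<integral>\<^sup>+x. ennreal (F x powr r) \<partial>M1) \<le> 1" and Gs: "(\<integral>\<^sup>+x. ennreal (G x powr s) \<partial>M2) \<le> 1"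
  shows "(\<integral>\<^sup>+u. (\<integral>\<^sup>+v. ennreal (F u * G v * K (u, v) powr - l) \<partial>M2) \<partial>M1)
    \<le> ennreal (Q * V powr (l / Q) / (r * s * (Q - l)) *
         (((l / Q) / (1 - 1 / r)) powr (l / Q) + ((l / Q) / (1 - 1 / s)) powr (l / Q)))"
proof -
  define k where "k u v = ennreal (K (u, v) powr - l)" for u v
  have [measurable]: "(\<lambda>x. k (fst x) (snd x)) \<in> borel_measurable (M1 \<Otimes>\<^sub>M M2)"
    by (simp add: k_def)
  have [measurable]: "(\<lambda>x. k (snd x) (fst x)) \<in> borel_measurable (M2 \<Otimes>\<^sub>M M1)"
    unfolding k_def by measurable
  have [measurable]: "k u \<in> borel_measurable M2" if "u \<in> space M1" for u
    using that unfolding k_def by measurable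
  have [measurable]: "(\<lambda>u. k u v) \<in> borel_measurable M1" if "v \<in> space M2" for v
    using that unfolding k_def by measurable
  let ?A = "\<lambda>a. {u \<in> space M1. a < F u}" and ?B = "\<lambda>b. {v \<in> space M2. b < G v}"
  define p where "p a = measure M1 (?A a)" for a
  define q where "q b = measure M2 (?B b)" for b
  define c where "c = Q / (Q - l) * V powr (l / Q)"
  \<comment> \<open>The kernel integrated over \<open>?A a\<close> and \<open>?B b\<close>, with
    \<open>v\<close> outermost as in \<open>set_integral_le\<close>.\<close>
  define S where "S a b = (\<integral>\<^sup>+v. indicator {v. b < G v} v * (\<integral>\<^sup>+u. indicator {u. a < F u} u * k u v \<partial>M1) \<partial>M2)" for a b
  have r0: "0 < r" and s0: "0 < s" using r s by auto
  note Fl = M1.superlevel_measure[OF F F0 r0 Fr, folded p_def]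
  note Gl = M2.superlevel_measure[OF G G0 s0 Gs, folded q_def]
  have S: "S a b \<le> ennreal c * ennreal (min (p a * q b powr (1 - l / Q)) (p a powr (1 - l / Q) * q b))"
    if "0 < a" "0 < b" for a b
  proof -
    have "S a b = (\<integral>\<^sup>+v. (\<integral>\<^sup>+u. ennreal (K (u, v) powr - l) * indicator (?A a) u \<partial>M1) * indicator (?B b) v \<partial>M2)"
      unfolding S_def k_def
      by (intro nn_integral_cong) (auto intro!: nn_integral_cong split: split_indicator)
    then show ?thesis
      using set_integral_le[OF l, of "?A a" "?B b"] Fl(1) Gl(1) that by (simp add: p_def q_def c_def)
  qed
  have "(\<integral>\<^sup>+u. (\<integral>\<^sup>+v. ennreal (F u * G v * K (u, v) powr - l) \<partial>M2) \<partial>M1)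
     = (\<integral>\<^sup>+u. ennreal (F u) * (\<integral>\<^sup>+v. ennreal (G v) * k u v \<partial>M2) \<partial>M1)"
    unfolding k_def
    by (intro nn_integral_cong) (simp add: ennreal_mult F0 G0 nn_integral_cmult[symmetric] mult.assoc)
  also have "\<dots> = (\<integral>\<^sup>+a. (\<integral>\<^sup>+u. indicator {u. a < F u} u * (\<integral>\<^sup>+v. ennreal (G v) * k u v \<partial>M2) \<partial>M1) * indicator {0<..} a \<partial>lborel)"
    using F0 by (intro M1.nn_integral_layer_cake F) auto
  \<comment> \<open>Tonelli moves \<open>v\<close> outside so that \<open>G\<close> can be layered
    next, with the inner \<open>u\<close>-integral as weight.\<close>
  also have "\<dots> = (\<integral>\<^sup>+a. (\<integral>\<^sup>+v. ennreal (G v) * (\<integral>\<^sup>+u. indicator {u. a < F u} u * k u v \<partial>M1) \<partial>M2) * indicator {0<..} a \<partial>lborel)"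
  proof (intro nn_integral_cong arg_cong2[where f="(*)"] refl)
    fix a :: real
    have "(\<integral>\<^sup>+u. indicator {u. a < F u} u * (\<integral>\<^sup>+v. ennreal (G v) * k u v \<partial>M2) \<partial>M1)
      = (\<integral>\<^sup>+u. (\<integral>\<^sup>+v. indicator {u. a < F u} u * (ennreal (G v) * k u v) \<partial>M2) \<partial>M1)"
      by (intro nn_integral_cong nn_integral_cmult[symmetric]) simp
    also have "\<dots> = (\<integral>\<^sup>+v. (\<integral>\<^sup>+u. indicator {u. a < F u} u * (ennreal (G v) * k u v) \<partial>M1) \<partial>M2)"
      by (intro Fubini'[symmetric]) simp
    also have "\<dots> = (\<integral>\<^sup>+v. ennreal (G v) * (\<integral>\<^sup>+u. indicator {u. a < F u} u * k u v \<partial>M1) \<partial>M2)"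
      by (intro nn_integral_cong, subst nn_integral_cmult[symmetric]) (auto simp: mult_ac)
    finally show "(\<integral>\<^sup>+u. indicator {u. a < F u} u * (\<integral>\<^sup>+v. ennreal (G v) * k u v \<partial>M2) \<partial>M1)
      = (\<integral>\<^sup>+v. ennreal (G v) * (\<integral>\<^sup>+u. indicator {u. a < F u} u * k u v \<partial>M1) \<partial>M2)" .
  qed
  also have "\<dots> = (\<integral>\<^sup>+a. (\<integral>\<^sup>+b. S a b * indicator {0<..} b \<partial>lborel) * indicator {0<..} a \<partial>lborel)"
    unfolding S_def using G0
    by (intro nn_integral_cong arg_cong2[where f="(*)"] refl M2.nn_integral_layer_cake G) auto
  also have "\<dots> \<le> (\<integral>\<^sup>+a. (\<integral>\<^sup>+b. ennreal c * (ennreal (min (p a * q b powr (1 - l / Q)) (p a powr (1 - l / Q) * q b))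
        * indicator {0<..} b) \<partial>lborel) * indicator {0<..} a \<partial>lborel)"
  proof (intro nn_integral_mono)
    fix a :: real
    show "(\<integral>\<^sup>+b. S a b * indicator {0<..} b \<partial>lborel) * indicator {0<..} a
      \<le> (\<integral>\<^sup>+b. ennreal c * (ennreal (min (p a * q b powr (1 - l / Q)) (p a powr (1 - l / Q) * q b))
        * indicator {0<..} b) \<partial>lborel) * indicator {0<..} a"
      \<comment> \<open>The bound on \<open>S a b\<close> is available at positive levels only;
        elsewhere the indicators vanish.\<close>
      using S[of a] by (cases "0 < a") (auto intro!: nn_integral_mono split: split_indicator)
  qed
  also have "\<dots> = ennreal c * (\<integral>\<^sup>+a. (\<integral>\<^sup>+b. ennreal (min (p a * q b powr (1 - l / Q)) (p a powr (1 - l / Q) * q b))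
        * indicator {0<..} b \<partial>lborel) * indicator {0<..} a \<partial>lborel)"
    using Fl(2) Gl(2) by (simp add: nn_integral_cmult mult.assoc)
  also have "\<dots> \<le> ennreal c * ennreal (1 / (r * s) * (((l / Q) / (1 - 1 / r)) powr (l / Q) + ((l / Q) / (1 - 1 / s)) powr (l / Q)))"
    using l r s exps Fl(2,3) Gl(2,3)
    by (intro mult_left_mono nn_integral_min_powr_le) (auto simp: p_def q_def)
  also have "\<dots> = ennreal (c * (1 / (r * s) * (((l / Q) / (1 - 1 / r)) powr (l / Q) + ((l / Q) / (1 - 1 / s)) powr (l / Q))))"
    using l r s by (intro ennreal_mult[symmetric]) (auto simp: c_def)
  also have "c * (1 / (r * s) * (((l / Q) / (1 - 1 / r)) powr (l / Q) + ((l / Q) / (1 - 1 / s)) powr (l / Q)))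
    = Q * V powr (l / Q) / (r * s * (Q - l)) *
         (((l / Q) / (1 - 1 / r)) powr (l / Q) + ((l / Q) / (1 - 1 / s)) powr (l / Q))"
    by (simp add: c_def)
  finally show ?thesis .
qed

end

subsection \<open>Volume of Heisenberg balls\<close>

text \<open>Completion does not change the measure of Borel sets, so a countable cover for
  \<open>lborel\<close> still serves.\<close>

lemma sigma_finite_lebesgue: "sigma_finite_measure (lebesgue :: 'a::euclidean_space measure)"
proof
  obtain A :: "'a set set" where A: "countable A" "A \<subseteq> sets lborel" "\<Union>A = space lborel"
    "\<forall>a\<in>A. emeasure lborel a \<noteq> \<infinity>"
    using lborel.sigma_finite_countable by blast
  show "\<exists>A :: 'a set set. countable A \<and> A \<subseteq> sets lebesgue \<and> \<Union>A = space lebesgue \<and> (\<forall>a\<in>A. emeasure lebesgue a \<noteq> (\<infinity> :: ennreal))"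
    by (rule exI[of _ A]) (use A in \<open>auto dest: sets_completionI_sets\<close>)
qed

lemma heis_norm_nonneg: "0 \<le> heis_norm u"
  by (simp add: heis_norm_def)

lemma heis_norm_less_iff:
  assumes "0 < c"
  shows "heis_norm u < c \<longleftrightarrow> norm (fst u) ^ 4 + (snd u)\<^sup>2 < c ^ 4"
proof -
  let ?x = "norm (fst u) ^ 4 + (snd u)\<^sup>2"
  have x: "0 \<le> ?x" by simp
  have "c = (c ^ 4) powr (1 / 4)"
    using assms powr_powr[of c 4 "1 / 4"] by (simp add: powr_realpow)
  then have "heis_norm u < c \<longleftrightarrow> ?x powr (1 / 4) < (c ^ 4) powr (1 / 4)"
    by (simp add: heis_norm_def)
  also have "\<dots> \<longleftrightarrow> ?x < c ^ 4"
    using x assms by (smt (verit) powr_less_mono2 powr_mono2 divide_pos_pos zero_less_power)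
  finally show ?thesis .
qed

lemma heis_dist_measurable:
  "(\<lambda>x. heis_norm (heis_mult (heis_inv (fst x)) (snd x))) \<in> borel_measurable borel"
  unfolding heis_norm_def heis_mult_def heis_inv_def herm_dot_def
  by (intro powr_real_measurable borel_measurable_continuous_onI) (auto intro!: continuous_intros)

text \<open>The two products are inverse to each other, and \<open>heis_norm\<close> is invariant
  under inversion. This transfers the volume of balls in \<open>v\<close> to balls in
  \<open>u\<close>.\<close>

lemma heis_norm_inv_mult_commute:
  "heis_norm (heis_mult (heis_inv v) u) = heis_norm (heis_mult (heis_inv u) v)"
proof -
  have "Im (herm_dot (- fst v) (fst u)) = - Im (herm_dot (- fst u) (fst v))"
    by (simp add: herm_dot_def sum_negf[symmetric] mult.commute)
  then have "snd (heis_mult (heis_inv v) u) = - snd (heis_mult (heis_inv u) v)"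
    by (simp add: heis_mult_def heis_inv_def)
  moreover have "norm (fst (heis_mult (heis_inv v) u)) = norm (fst (heis_mult (heis_inv u) v))"
    by (simp add: heis_mult_def heis_inv_def norm_minus_commute)
  ultimately show ?thesis by (simp add: heis_norm_def)
qed

section \<open>Left invariance of Lebesgue measure\<close>

lemma emeasure_lborel_translate:
  fixes A :: "'a::euclidean_space set"
  assumes "A \<in> sets borel"
  shows "emeasure lborel {x. c + x \<in> A} = emeasure lborel A"
proof -
  have "emeasure lborel A = emeasure (distr lborel borel ((+) c)) A"
    by (simp add: lborel_distr_plus)
  also have "\<dots> = emeasure lborel {x. c + x \<in> A}"
    using assms by (subst emeasure_distr) (auto simp: vimage_def)
  finally show ?thesis ..
qed

lemma nn_integral_lborel_translate:
  fixes f :: "'a::euclidean_space \<Rightarrow> ennreal"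
  assumes "f \<in> borel_measurable borel"
  shows "(\<integral>\<^sup>+x. f (c + x) \<partial>lborel) = (\<integral>\<^sup>+x. f x \<partial>lborel)"
proof -
  have "(\<integral>\<^sup>+x. f x \<partial>lborel) = (\<integral>\<^sup>+x. f x \<partial>distr lborel borel ((+) c))"
    by (simp add: lborel_distr_plus)
  also have "\<dots> = (\<integral>\<^sup>+x. f (c + x) \<partial>lborel)"
    using assms by (subst nn_integral_distr) auto
  finally show ?thesis ..
qed

text \<open>Left multiplication is a shear followed by a translation: at fixed \<open>z\<close> it
  shifts \<open>t\<close> by an amount depending on \<open>z\<close> alone, and \<open>z\<close>
  itself is shifted by \<open>fst u\<close>. Slicing thus reduces the claim to Euclidean translation
  invariance in each factor.\<close>

lemma emeasure_lborel_left_mult: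
  fixes A :: "('n::finite) heis set"
  assumes A: "A \<in> sets borel"
  shows "emeasure lborel {v. heis_mult u v \<in> A} = emeasure lborel A"
proof -
  have B: "{v. heis_mult u v \<in> A} \<in> sets borel"
  proof -
    have "heis_mult u \<in> borel_measurable borel"
      unfolding heis_mult_def herm_dot_def
      by (intro borel_measurable_continuous_onI continuous_intros)
    from measurable_sets[OF this A] show ?thesis by (simp add: vimage_def)
  qed
  have slice: "emeasure lborel X = (\<integral>\<^sup>+z. emeasure lborel {t. (z, t) \<in> X} \<partial>lborel)"
    if "X \<in> sets borel" for X :: "'n heis set"
  proof -
    have "X \<in> sets (lborel \<Otimes>\<^sub>M lborel)" using that by (simp only: lborel_prod sets_lborel)
    from lborel.emeasure_pair_measure_alt[OF this] show ?thesis
      by (simp only: lborel_prod vimage_def)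
  qed
  have Az: "{t. (z, t) \<in> A} \<in> sets borel" for z
  proof -
    have "Pair z \<in> borel_measurable borel"
      by (intro borel_measurable_continuous_onI continuous_intros)
    from measurable_sets[OF this A] show ?thesis by (simp add: vimage_def)
  qed
  have "emeasure lborel {v. heis_mult u v \<in> A}
      = (\<integral>\<^sup>+z. emeasure lborel {t. (snd u + 2 * Im (herm_dot (fst u) z)) + t \<in> {t. (fst u + z, t) \<in> A}} \<partial>lborel)"
    unfolding slice[OF B] by (simp add: heis_mult_def add_ac)
  also have "\<dots> = (\<integral>\<^sup>+z. emeasure lborel {t. (fst u + z, t) \<in> A} \<partial>lborel)"
    by (simp only: emeasure_lborel_translate Az)
  also have "\<dots> = (\<integral>\<^sup>+z. emeasure lborel {t. (z, t) \<in> A} \<partial>lborel)"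
  proof (rule nn_integral_lborel_translate[where f="\<lambda>z. emeasure lborel {t. (z, t) \<in> A}"])
    have "A \<in> sets (lborel \<Otimes>\<^sub>M lborel)" using A by (simp only: lborel_prod sets_lborel)
    from lborel.measurable_emeasure_Pair[OF this]
    show "(\<lambda>z. emeasure lborel {t. (z, t) \<in> A}) \<in> borel_measurable borel"
      by (simp add: vimage_def)
  qed
  also have "\<dots> = emeasure lborel A" by (simp only: slice[OF A])
  finally show ?thesis .
qed

lemma open_heis_ball: "open (heis_ball c :: ('n::finite) heis set)"
  unfolding heis_ball_def heis_norm_def
  by (intro open_Collect_less continuous_on_powr' continuous_intros) auto

text \<open>Slicing along the central variable \<open>t\<close> produces Euclidean balls of radius \<open>(c\<^sup>4 - t\<^sup>2)\<^sup>1\<^sup>/\<^sup>4\<close>.\<close>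

lemma emeasure_heis_ball:
  assumes c: "0 < c"
  shows "emeasure lborel (heis_ball c :: ('n::finite) heis set)
    = ennreal (unit_ball_vol (2 * real CARD('n)) * Beta (1 / 2) (real CARD('n) / 2 + 1) * c ^ (2 * CARD('n) + 2))"
proof -
  let ?n = "CARD('n)" and ?B = "heis_ball c :: 'n heis set"
  let ?w = "unit_ball_vol (2 * real ?n)"
  have meas: "?B \<in> sets (lborel \<Otimes>\<^sub>M lborel)"
    using borel_open[OF open_heis_ball] by (simp only: lborel_prod sets_lborel)
  \<comment> \<open>Written in the rescaled variable \<open>t / c\<^sup>2\<close>, so that the
    powers of \<open>c\<close> separate from a fixed Beta integral.\<close>
  have slice: "emeasure lborel {z. (z, t) \<in> ?B} = ennreal (?w * c ^ (2 * ?n)) * (indicator {-1..1} (t / c\<^sup>2) * ennreal (sqrt (1 - (t / c\<^sup>2)\<^sup>2) ^ ?n))" for t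
  proof -
    have iff: "(z, t) \<in> ?B \<longleftrightarrow> norm z ^ 4 < c ^ 4 - t\<^sup>2" for z
      by (auto simp: heis_ball_def heis_norm_less_iff[OF c])
    have c4: "c ^ 4 = (c\<^sup>2)\<^sup>2" by simp
    show ?thesis
    proof (cases "\<bar>t\<bar> < c\<^sup>2")
      case True
      then have t: "t\<^sup>2 < c ^ 4" unfolding c4
        using power_strict_mono[OF True, of 2] by simp
      define \<rho> where "\<rho> = sqrt (sqrt (c ^ 4 - t\<^sup>2))"
      have \<rho>: "0 \<le> \<rho>" "\<rho>\<^sup>2 = sqrt (c ^ 4 - t\<^sup>2)"
        using t by (auto simp: \<rho>_def)
      moreover have "\<rho> ^ 4 = (\<rho>\<^sup>2)\<^sup>2" by simp
      ultimately have \<rho>4: "c ^ 4 - t\<^sup>2 = \<rho> ^ 4" using t by simp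
      have "{z. (z, t) \<in> ?B} = ball 0 \<rho>"
        unfolding iff \<rho>4 using \<rho>(1) by (auto intro: power_strict_mono power_less_imp_less_base)
      then have "emeasure lborel {z. (z, t) \<in> ?B} = ennreal (?w * \<rho> ^ (2 * ?n))"
        using \<rho>(1) by (simp add: emeasure_ball mult.commute)
      also have "\<rho> ^ (2 * ?n) = c ^ (2 * ?n) * sqrt (1 - (t / c\<^sup>2)\<^sup>2) ^ ?n"
      proof -
        have "c ^ 4 - t\<^sup>2 = (c\<^sup>2)\<^sup>2 * (1 - (t / c\<^sup>2)\<^sup>2)" using c by (simp add: field_simps)
        then have "\<rho>\<^sup>2 = c\<^sup>2 * sqrt (1 - (t / c\<^sup>2)\<^sup>2)"
          unfolding \<rho>(2) by (simp only: real_sqrt_mult real_sqrt_abs abs_power2)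
        then show ?thesis by (simp add: power_mult power_mult_distrib)
      qed
      finally have "emeasure lborel {z. (z, t) \<in> ?B} = ennreal (?w * c ^ (2 * ?n)) * ennreal (sqrt (1 - (t / c\<^sup>2)\<^sup>2) ^ ?n)"
        using c by (simp only: ennreal_mult'[symmetric] mult.assoc mult_nonneg_nonneg unit_ball_vol_nonneg
          of_nat_0_le_iff zero_le_power less_imp_le zero_le_numeral)
      moreover have "indicator {-1..1} (t / c\<^sup>2) = (1 :: ennreal)"
        using True c by (auto simp: abs_less_iff field_simps)
      ultimately show ?thesis by simp
    next
      case False
      then have "c ^ 4 \<le> t\<^sup>2" unfolding c4 by (metis abs_ge_zero linorder_not_less power2_abs power_mono zero_le_power2)
      then have "{z. (z, t) \<in> ?B} = {}" unfolding iff by (auto simp: not_less intro: order_trans[OF _ zero_le_power])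
      moreover have "indicator {-1..1} (t / c\<^sup>2) * ennreal (sqrt (1 - (t / c\<^sup>2)\<^sup>2) ^ ?n) = 0"
      \<comment> \<open>At the endpoints the closed interval's indicator is 1, but the square root
        vanishes, and so does its power since \<open>CARD('n)\<close> is positive.\<close>
      proof (cases "\<bar>t / c\<^sup>2\<bar> = 1")
        case True
        then have "(t / c\<^sup>2)\<^sup>2 = 1" by (metis power2_abs one_power2)
        then show ?thesis by simp
      next
        case False
        with \<open>\<not> \<bar>t\<bar> < c\<^sup>2\<close> have "\<bar>t / c\<^sup>2\<bar> > 1" using c by (simp add: abs_divide field_simps)
        then show ?thesis by (auto split: split_indicator)
      qed
      ultimately show ?thesis by simp
    qed
  qed
  have "emeasure lborel ?B = (\<integral>\<^sup>+t. emeasure lborel {z. (z, t) \<in> ?B} \<partial>lborel)"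
    using lborel_pair.emeasure_pair_measure_alt2[OF meas] by (simp only: lborel_prod vimage_def)
  also have "\<dots> = ennreal (?w * c ^ (2 * ?n)) * (\<integral>\<^sup>+t. indicator {-1..1} (t / c\<^sup>2) * ennreal (sqrt (1 - (t / c\<^sup>2)\<^sup>2) ^ ?n) \<partial>lborel)"
    unfolding slice by (rule nn_integral_cmult) simp
  \<comment> \<open>The Jacobian \<open>c\<^sup>2\<close> raises the exponent from
    \<open>2 * n\<close> to the homogeneous dimension \<open>2 * n + 2\<close>.\<close>
  also have "(\<integral>\<^sup>+t. indicator {-1..1} (t / c\<^sup>2) * ennreal (sqrt (1 - (t / c\<^sup>2)\<^sup>2) ^ ?n) \<partial>lborel)
     = ennreal (c\<^sup>2) * (\<integral>\<^sup>+t. indicator {-1..1} t * ennreal (sqrt (1 - t\<^sup>2) ^ ?n) \<partial>lborel)"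
    using c by (subst nn_integral_real_affine[where c="c\<^sup>2" and t=0]) auto
  also have "(\<integral>\<^sup>+t. indicator {-1..1} t * ennreal (sqrt (1 - t\<^sup>2) ^ ?n) \<partial>lborel) = ennreal (Beta (1 / 2) (real ?n / 2 + 1))"
    by (subst emeasure_cball_aux_integral[symmetric]) (auto intro!: nn_integral_cong split: split_indicator)
  also have "ennreal (?w * c ^ (2 * ?n)) * (ennreal (c\<^sup>2) * ennreal (Beta (1 / 2) (real ?n / 2 + 1)))
    = ennreal (?w * Beta (1 / 2) (real ?n / 2 + 1) * c ^ (2 * ?n + 2))"
    using c by (simp add: ennreal_mult[symmetric] Beta_def Gamma_real_pos less_imp_le power_add power2_eq_square mult_ac)
  finally show ?thesis .
qed

text \<open>Each Lebesgue sigma-algebra contains the Borel one, hence their product contains the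
  Borel sets of the product space.\<close>

lemma lebesgue_pair_measurable:
  assumes "f \<in> borel_measurable (borel :: ('a::euclidean_space \<times> 'b::euclidean_space) measure)"
  shows "f \<in> borel_measurable (lebesgue \<Otimes>\<^sub>M lebesgue)"
proof -
  have "(\<lambda>x. (fst x, snd x)) \<in> (lebesgue \<Otimes>\<^sub>M lebesgue) \<rightarrow>\<^sub>M (borel \<Otimes>\<^sub>M borel :: ('a \<times> 'b) measure)"
    using measurable_compose[OF measurable_fst id_borel_measurable_lebesgue, of "lebesgue :: 'b measure"]
      measurable_compose[OF measurable_snd id_borel_measurable_lebesgue, of "lebesgue :: 'a measure"]
    by (intro measurable_Pair) (simp_all add: id_def)
  then show ?thesis
    using measurable_compose[of _ _ borel f borel] assms by (simp add: borel_prod)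
qed

lemma measure_heis_ball_1:
  "measure lebesgue (heis_ball 1 :: ('n::finite) heis set)
     = unit_ball_vol (2 * real CARD('n)) * Beta (1 / 2) (real CARD('n) / 2 + 1)"
proof -
  have "0 \<le> unit_ball_vol (2 * real CARD('n)) * Beta (1 / 2) (real CARD('n) / 2 + 1)"
    by (simp add: Beta_def Gamma_real_pos less_imp_le)
  moreover have "(heis_ball 1 :: 'n heis set) \<in> sets borel" by (rule borel_open[OF open_heis_ball])
  ultimately show ?thesis
    using emeasure_heis_ball[of 1, where ?'n='n]
    by (simp add: measure_def)
qed

lemma emeasure_heis_ball_translate:
  fixes u :: "('n::finite) heis"
  assumes c: "0 < c"
  shows "emeasure lebesgue {v. heis_norm (heis_mult (heis_inv u) v) < c}
     = ennreal (measure lebesgue (heis_ball 1 :: 'n heis set) * c powr (2 * real CARD('n) + 2))"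
proof -
  have B: "(heis_ball c :: 'n heis set) \<in> sets borel" by (rule borel_open[OF open_heis_ball])
  have "{v. heis_norm (heis_mult (heis_inv u) v) < c} \<in> sets borel"
    unfolding heis_norm_def heis_mult_def heis_inv_def herm_dot_def
    by (intro borel_open open_Collect_less continuous_on_powr' continuous_intros) auto
  then have "emeasure lebesgue {v. heis_norm (heis_mult (heis_inv u) v) < c}
      = emeasure lborel {v. heis_mult (heis_inv u) v \<in> heis_ball c}"
    by (simp add: heis_ball_def)
  also have "\<dots> = emeasure lborel (heis_ball c :: 'n heis set)"
    by (rule emeasure_lborel_left_mult[OF B])
  also have "\<dots> = ennreal (measure lebesgue (heis_ball 1 :: 'n heis set) * c ^ (2 * CARD('n) + 2))"
    by (simp add: emeasure_heis_ball[OF c] measure_heis_ball_1)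
  also have "c ^ (2 * CARD('n) + 2) = c powr (2 * real CARD('n) + 2)"
    using powr_realpow[OF c, of "2 * CARD('n) + 2"] by (simp add: add_ac)
  finally show ?thesis .
qed

section \<open>Normalization and the inequality on the Heisenberg group\<close>

lemma nn_integral_normalized_le_1:
  fixes f :: "'a::euclidean_space \<Rightarrow> complex"
  assumes f: "f \<in> Lp_space p" and p: "0 < p" and e: "0 < e"
  shows "(\<integral>\<^sup>+x. ennreal ((cmod (f x) / (Lp_norm p f + e)) powr p) \<partial>lebesgue) \<le> 1"
proof -
  define I where "I = (\<integral>x. cmod (f x) powr p \<partial>lebesgue)"
  define N where "N = Lp_norm p f + e"
  have I0: "0 \<le> I" by (simp add: I_def)
  have N: "0 < N" using e by (simp add: N_def Lp_norm_def add_nonneg_pos)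
  have "I powr (1 / p) \<le> N" using e by (simp add: N_def Lp_norm_def I_def)
  then have "(I powr (1 / p)) powr p \<le> N powr p" using p by (intro powr_mono2) auto
  then have IN: "I \<le> N powr p" using p I0 by (simp add: powr_powr)
  have "(\<integral>\<^sup>+x. ennreal ((cmod (f x) / N) powr p) \<partial>lebesgue)
    = (\<integral>\<^sup>+x. ennreal (1 / N powr p) * ennreal (cmod (f x) powr p) \<partial>lebesgue)"
    using N by (intro nn_integral_cong) (simp add: powr_divide ennreal_mult[symmetric])
  also have "\<dots> = ennreal (1 / N powr p) * ennreal I"
    using f nn_integral_eq_integral[of lebesgue "\<lambda>x. cmod (f x) powr p"]
    by (subst nn_integral_cmult) (auto simp: Lp_space_def I_def)
  also have "\<dots> = ennreal (I / N powr p)"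
    using I0 by (simp add: ennreal_mult[symmetric])
  also have "\<dots> \<le> 1" using IN N by (simp add: field_simps)
  finally show ?thesis by (simp add: N_def)
qed

theorem theorem2:
  fixes r s l Q vol C :: real
  assumes Q: "Q = 2 * real CARD('n::finite) + 2"
    and r: "1 < r" and s: "1 < s"
    and l: "0 < l" "l < Q"
    and exponents: "1 / r + 1 / s + l / Q = 2"
    and vol: "vol = measure lebesgue (heis_ball 1 :: ('n heis) set)"
    and C: "C = Q * vol powr (l / Q) / (r * s * (Q - l)) *
              (((l / Q) / (1 - 1 / r)) powr (l / Q) + ((l / Q) / (1 - 1 / s)) powr (l / Q))"
  shows "(\<forall>f \<in> Lp_space r. \<forall>g \<in> Lp_space s.
            integrable (lebesgue \<Otimes>\<^sub>M lebesgue) (HLS_integrand l f (g :: 'n heis \<Rightarrow> complex)) \<and>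
            cmod (\<integral>x. HLS_integrand l f g x \<partial>(lebesgue \<Otimes>\<^sub>M lebesgue))
              \<le> C * Lp_norm r f * Lp_norm s g) \<and>
         vol = 2 * pi powr ((Q - 2) / 2) * Gamma (1 / 2) * Gamma ((Q + 2) / 4) /
               ((Q - 2) * Gamma ((Q - 2) / 2) * Gamma ((Q + 4) / 4))"
proof (intro conjI ballI)
  define n where "n = real CARD('n)"
  have n: "0 < n" by (simp add: n_def)
  \<comment> \<open>Excludes the poles of Gamma. The recursion turns the
    \<open>Gamma (n + 1)\<close> of the Euclidean ball volume into the factors \<open>Q - 2\<close>
    and \<open>Gamma ((Q - 2) / 2)\<close> of the stated formula.\<close>
  have "n \<notin> \<int>\<^sub>\<le>\<^sub>0" using n nonpos_Ints_nonpos by fastforce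
  then have G: "Gamma (n + 1) = n * Gamma n" by (rule Gamma_plus1)
  have Qn: "(Q - 2) / 2 = n" "Q - 2 = 2 * n" "(Q + 2) / 4 = n / 2 + 1" "(Q + 4) / 4 = 1 / 2 + (n / 2 + 1)"
    by (simp_all add: Q n_def field_simps)
  have "vol = pi powr n / Gamma (n + 1) * (Gamma (1 / 2) * Gamma (n / 2 + 1) / Gamma (1 / 2 + (n / 2 + 1)))"
    unfolding vol measure_heis_ball_1 n_def[symmetric] by (simp add: unit_ball_vol_def Beta_def)
  then show "vol = 2 * pi powr ((Q - 2) / 2) * Gamma (1 / 2) * Gamma ((Q + 2) / 4) /
               ((Q - 2) * Gamma ((Q - 2) / 2) * Gamma ((Q + 4) / 4))"
    unfolding Qn G by simp

  define K where "K x = heis_norm (heis_mult (heis_inv (fst x)) (snd x))" for x :: "'n heis \<times> 'n heis"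
  have vol_pos: "0 < vol"
    unfolding vol measure_heis_ball_1 by (simp add: Beta_def Gamma_real_pos)
  interpret leb: sigma_finite_measure "lebesgue :: 'n heis measure" by (rule sigma_finite_lebesgue)
  interpret hls_kernel "lebesgue :: 'n heis measure" "lebesgue :: 'n heis measure" K Q vol
  proof
    show "K \<in> borel_measurable (lebesgue \<Otimes>\<^sub>M lebesgue)"
      unfolding K_def by (intro lebesgue_pair_measurable heis_dist_measurable)
    show "emeasure lebesgue {u \<in> space lebesgue. K (u, v) < c} \<le> ennreal (vol * c powr Q)" if "0 < c" for v c
      using emeasure_heis_ball_translate[OF that, of v]
      by (simp add: K_def heis_norm_inv_mult_commute[of _ v] vol Q)
    show "emeasure lebesgue {v \<in> space lebesgue. K (u, v) < c} \<le> ennreal (vol * c powr Q)" if "0 < c" for u c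
      using emeasure_heis_ball_translate[OF that, of u] by (simp add: K_def vol Q)
  qed (auto simp: K_def heis_norm_nonneg vol_pos)

  fix f g :: "'n heis \<Rightarrow> complex"
  assume f: "f \<in> Lp_space r" and g: "g \<in> Lp_space s"
  have [measurable]: "f \<in> borel_measurable lebesgue" "g \<in> borel_measurable lebesgue"
    using f g by (auto simp: Lp_space_def)
  have C0: "0 \<le> C" using C l r s by simp
  \<comment> \<open>One bound on the absolute integral yields both integrability and the
    estimate.\<close>
  define J where "J = (\<integral>\<^sup>+x. ennreal (cmod (HLS_integrand l f g x)) \<partial>(lebesgue \<Otimes>\<^sub>M lebesgue))"
  have integrand: "HLS_integrand l f g = (\<lambda>x. cnj (f (fst x)) * g (snd x) / complex_of_real (K x powr l))"
    by (auto simp: HLS_integrand_def K_def fun_eq_iff)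
  have meas[measurable]: "HLS_integrand l f g \<in> borel_measurable (lebesgue \<Otimes>\<^sub>M lebesgue)"
  proof -
    have "(\<lambda>x. cnj (f x)) \<in> borel_measurable lebesgue"
      by (rule measurable_compose[of f _ borel]) (auto intro!: borel_measurable_continuous_onI continuous_intros)
    then show ?thesis unfolding integrand by measurable
  qed
  \<comment> \<open>The shift by \<open>e\<close> keeps the normalizing factors positive when a norm vanishes.\<close>
  have J_le: "J \<le> ennreal (C * (Lp_norm r f + e) * (Lp_norm s g + e))" if e: "0 < e" for e
  proof -
    define N where "N = Lp_norm r f + e"
    define P where "P = Lp_norm s g + e"
    have NP: "0 < N" "0 < P" using e by (simp_all add: N_def P_def Lp_norm_def add_nonneg_pos)
    have "J = (\<integral>\<^sup>+u. \<integral>\<^sup>+v. ennreal (cmod (HLS_integrand l f g (u, v))) \<partial>lebesgue \<partial>lebesgue)"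
      unfolding J_def by (rule leb.nn_integral_fst[symmetric]) measurable
    \<comment> \<open>Where \<open>K (u, v) = 0\<close> both integrands are 0: division by zero on
      one side agrees with \<open>0 powr - l = 0\<close> on the other.\<close>
    also have "\<dots> = (\<integral>\<^sup>+u. \<integral>\<^sup>+v. ennreal (N * P) * ennreal (cmod (f u) / N * (cmod (g v) / P) * K (u, v) powr - l) \<partial>lebesgue \<partial>lebesgue)"
      using NP by (intro nn_integral_cong)
        (simp add: integrand ennreal_mult[symmetric] norm_mult norm_divide powr_minus_divide)
    also have "\<dots> = ennreal (N * P) * (\<integral>\<^sup>+u. \<integral>\<^sup>+v. ennreal (cmod (f u) / N * (cmod (g v) / P) * K (u, v) powr - l) \<partial>lebesgue \<partial>lebesgue)"
    proof -
      have "(\<integral>\<^sup>+v. ennreal (N * P) * ennreal (cmod (f u) / N * (cmod (g v) / P) * K (u, v) powr - l) \<partial>lebesgue)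
        = ennreal (N * P) * (\<integral>\<^sup>+v. ennreal (cmod (f u) / N * (cmod (g v) / P) * K (u, v) powr - l) \<partial>lebesgue)" for u
        by (rule nn_integral_cmult) simp
      then show ?thesis by (simp add: nn_integral_cmult)
    qed
    also have "\<dots> \<le> ennreal (N * P) * ennreal C"
      unfolding C using NP r s nn_integral_normalized_le_1[OF f _ e] nn_integral_normalized_le_1[OF g _ e]
      by (intro mult_left_mono hls_normalized l r s exponents) (simp_all add: N_def P_def)
    also have "\<dots> = ennreal (C * N * P)"
      using NP C0 by (simp add: ennreal_mult[symmetric] mult_ac)
    finally show ?thesis by (simp add: N_def P_def)
  qed
  have J_fin: "J < \<infinity>" using J_le[of 1] by (simp add: le_less_trans)
  then show int: "integrable (lebesgue \<Otimes>\<^sub>M lebesgue) (HLS_integrand l f g)"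
    using meas by (intro integrableI_bounded) (auto simp: J_def)
  have "cmod (\<integral>x. HLS_integrand l f g x \<partial>(lebesgue \<Otimes>\<^sub>M lebesgue)) \<le> C * (Lp_norm r f + e) * (Lp_norm s g + e)"
    if e: "0 < e" for e
  proof -
    have "ennreal (cmod (\<integral>x. HLS_integrand l f g x \<partial>(lebesgue \<Otimes>\<^sub>M lebesgue))) \<le> J"
      unfolding J_def by (rule integral_norm_bound_ennreal[OF int])
    also note J_le[OF e]
    finally show ?thesis
      using C0 e by (subst (asm) ennreal_le_iff) (auto simp: Lp_norm_def)
  qed
  \<comment> \<open>The bound holds for every \<open>e > 0\<close> and its right side is continuous
    in \<open>e\<close>; letting \<open>e\<close> decrease to 0 removes the shift.\<close>
  then show "cmod (\<integral>x. HLS_integrand l f g x \<partial>(lebesgue \<Otimes>\<^sub>M lebesgue)) \<le> C * Lp_norm r f * Lp_norm s g"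
    by (intro tendsto_lowerbound[where f="\<lambda>e. C * (Lp_norm r f + e) * (Lp_norm s g + e)" and F="at_right 0"])
       (auto intro!: tendsto_eq_intros eventually_at_right_less[THEN eventually_mono])
qed

end
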